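(* Let $T>0$, assume $h_{\rm i}\in C^\infty(\overline{\mathcal I})$ is bounded from below by a positive constant, and let $u=(\zeta,v^{\rm T})^{\rm T}$ (with $h=H_0+\zeta$) satisfy $\mathtt gh(t,x)-|v(t,x)|^2\ge c_0$ for all $(t,x)\in(0,T)\times\mathcal E$ with some constant $c_0>0$. Define $$G_j=\begin{pmatrix}0&\mathbf e_j^{\rm T}\\ \mathbf e_j&0_{2\times2}\end{pmatrix}\ (j=1,2),\qquad\Sigma(u)=\begin{pmatrix}\mathtt g&v^{\rm T}\\ v&h\,{\rm Id}_{2\times2}\end{pmatrix}.$$ Then $\Sigma(u)$ is invertible on $(0,T)\times\mathcal E$, and $(\dot u,\dot\psi_{\rm i})$ is a regular solution of $$\begin{cases}\partial_t\dot u+\partial_j(A_j(u)\dot u)=\dot f&\text{in }(0,T)\times\mathcal E,\\ (A_{\rm nor}\dot u)^{\rm I}-\Lambda\dot\psi_{\rm i}=g_1&\text{on }(0,T)\times\mathit\Gamma,\\ \partial_t\dot\psi_{\rm i}+N\cdot(A_{\rm nor}\dot u)^{\rm II}=g_2&\text{on }(0,T)\times\mathit\Gamma\end{cases}$$ if and only if $\check u:=\Sigma(u)\dot u$ and $\check\psi_{\rm i}:=\dot\psi_{\rm i}$ solve $$\begin{cases}\partial_t\check u+\Sigma(u)G_j\partial_j\check u+B(u,\partial_tu)\check u=\Sigma(u)\dot f&\text{in }(0,T)\times\mathcal E,\\ N\cdot\check u^{\rm II}-\Lambda\check\psi_{\rm i}=g_1&\text{on }(0,T)\times\mathit\Gamma,\\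 \partial_t\check\psi_{\rm i}+\check u^{\rm I}=g_2&\text{on }(0,T)\times\mathit\Gamma,\end{cases}$$ where $B(u,\partial_tu)=\Sigma(u)\partial_t(\Sigma(u)^{-1})$.
   Context: $\mathit\Gamma\subset\mathbb R^2$ is a $C^\infty$ Jordan curve with interior $\mathcal I$ and exterior $\mathcal E$; $N$ is the unit normal on $\mathit\Gamma$ pointing into $\mathcal E$, extended to a tubular neighborhood $U_{\mathit\Gamma}$ of $\mathit\Gamma$ as constant along normals; $\mathfrak d_{\rm tan}$ is the derivative with respect to the tangential coordinate $s$ in the normal-tangential coordinates $x=\gamma(s)+rN$ of $U_{\mathit\Gamma}$ ($\gamma$ arc length parametrization); $\chi_{\rm b}$ is a smooth cutoff supported in $U_{\mathit\Gamma}$, depending only on $r$, equal to $1$ near $\mathit\Gamma$. $\mathtt g,H_0>0$ are constants. $\mathbf e_1,\mathbf e_2$ is the canonical basis of $\mathbb R^2$; summation over repeated indices; for $w=(w_1,w_2,w_3)^{\rm T}$, $w^{\rm I}=w_1$, $w^{\rm II}=(w_2,w_3)^{\rm T}$. $\mathcal F_j(u)=\big(hv_j,(\mathtt g\zeta+\tfrac12|v|^2)\mathbf e_j^{\rm T}\big)^{\rm T}$, $A_j(u)={\rm d}_u\mathcal F_j(u)=\begin{pmatrix}v_j&h\mathbf e_j^{\rm T}\\ \mathtt g\mathbf e_j&\mathbf e_j\otimes v\end{pmatrix}$ (where $\mathbf e_j\otimes v=\mathbf e_jv^{\rm T}$), $\mathcal F_{\rm nor}(u)=N_j\mathcal F_j(u)$,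 $A_{\rm nor}=N_jA_j(u)$. $\Lambda$ is the Dirichlet-to-Neumann map $\Lambda\psi=(N\cdot(h_{\rm i}\nabla\psi^{\mathfrak h}))_{|\mathit\Gamma}$, with $\nabla\cdot(h_{\rm i}\nabla\psi^{\mathfrak h})=0$ in $\mathcal I$, $\psi^{\mathfrak h}=\psi$ on $\mathit\Gamma$. The source terms, for $\mathfrak d_\parallel=\partial_t$ or $\mathfrak d_{\rm tan}$ and a given $(u,\psi_{\rm i})$, are $\dot f=-[\chi_{\rm b}\mathfrak d_\parallel,\partial_j]\mathcal F_j(u)$, $g_1=[\mathfrak d_\parallel,\Lambda]\psi_{\rm i}$, $g_2=-(\mathfrak d_\parallel N)\cdot\mathcal F_{\rm nor}(u)^{\rm II}$. All functions are assumed regular enough for the equations to hold classically. *)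

theory Defs
  imports "HOL-Analysis.Analysis"
begin

section \<open>Classical derivatives and regularity classes\<close>

definition dt :: "(real \<Rightarrow> real^2 \<Rightarrow> 'b::real_normed_vector) \<Rightarrow> real \<Rightarrow> real^2 \<Rightarrow> 'b" where
  "dt f t x = vector_derivative (\<lambda>\<tau>. f \<tau> x) (at t)"

definition dx :: "2 \<Rightarrow> (real^2 \<Rightarrow> 'b::real_normed_vector) \<Rightarrow> real^2 \<Rightarrow> 'b" where
  "dx j f x = frechet_derivative f (at x) (axis j 1)"

definition grad :: "(real^2 \<Rightarrow> real) \<Rightarrow> real^2 \<Rightarrow> real^2" where
  "grad f x = (\<chi> j. dx j f x)"

definition div2 :: "(real^2 \<Rightarrow> real^2) \<Rightarrow> real^2 \<Rightarrow> real" where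
  "div2 F x = (\<Sum>j\<in>UNIV. dx j (\<lambda>y. F y $ j) x)"

text \<open>\<open>k\<close> times continuously differentiable; meant for open \<open>S\<close>.\<close>

primrec Ck_on :: "nat \<Rightarrow> 'a::euclidean_space set \<Rightarrow> ('a \<Rightarrow> 'b::real_normed_vector) \<Rightarrow> bool" where
  "Ck_on 0 S f \<longleftrightarrow> continuous_on S f"
| "Ck_on (Suc k) S f \<longleftrightarrow> f differentiable_on S \<and>
     (\<forall>b\<in>Basis. Ck_on k S (\<lambda>x. frechet_derivative f (at x) b))"

definition smooth_on :: "'a::euclidean_space set \<Rightarrow> ('a \<Rightarrow> 'b::real_normed_vector) \<Rightarrow> bool" where
  "smooth_on S f \<longleftrightarrow> (\<forall>k. Ck_on k S f)"

text \<open>The class \<open>C\<^sup>k(closure S)\<close> for open \<open>S\<close>: the function is continuous on the closure, and all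
  derivatives on \<open>S\<close> up to order \<open>k\<close> extend continuously to the closure (\<open>g\<close> is the extension).\<close>

primrec Ck_closure :: "nat \<Rightarrow> 'a::euclidean_space set \<Rightarrow> ('a \<Rightarrow> 'b::real_normed_vector) \<Rightarrow> bool" where
  "Ck_closure 0 S f \<longleftrightarrow> continuous_on (closure S) f"
| "Ck_closure (Suc k) S f \<longleftrightarrow> continuous_on (closure S) f \<and> f differentiable_on S \<and>
     (\<forall>b\<in>Basis. \<exists>g. Ck_closure k S g \<and> (\<forall>x\<in>S. g x = frechet_derivative f (at x) b))"

definition smooth_closure :: "'a::euclidean_space set \<Rightarrow> ('a \<Rightarrow> 'b::real_normed_vector) \<Rightarrow> bool" where
  "smooth_closure S f \<longleftrightarrow> (\<forall>k. Ck_closure k S f)"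


section \<open>The curve, its normal and the normal-tangential coordinates\<close>

text \<open>\<open>\<gamma>\<close> is an \<open>L\<close>-periodic arc length parametrization of the smooth Jordan curve \<open>\<Gamma>\<close>. The interior
  and exterior of the curve are the library's \<open>inside \<Gamma>\<close> and \<open>outside \<Gamma>\<close>.\<close>

definition arclength_param :: "(real^2) set \<Rightarrow> (real \<Rightarrow> real^2) \<Rightarrow> real \<Rightarrow> bool" where
  "arclength_param \<Gamma> \<gamma> L \<longleftrightarrow> 0 < L \<and> smooth_on UNIV \<gamma> \<and> (\<forall>s. \<gamma> (s + L) = \<gamma> s) \<and>
     (\<forall>s. norm (vector_derivative \<gamma> (at s)) = 1) \<and>
     simple_path (\<lambda>\<theta>. \<gamma> (L * \<theta>)) \<and> \<Gamma> = path_image (\<lambda>\<theta>. \<gamma> (L * \<theta>))"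

definition outward_unit_normal ::
    "(real^2) set \<Rightarrow> (real \<Rightarrow> real^2) \<Rightarrow> (real^2 \<Rightarrow> real^2) \<Rightarrow> bool" where
  "outward_unit_normal \<Gamma> \<gamma> N \<longleftrightarrow>
     (\<forall>s. norm (N (\<gamma> s)) = 1 \<and> N (\<gamma> s) \<bullet> vector_derivative \<gamma> (at s) = 0 \<and>
          (\<exists>\<epsilon>>0. \<forall>r\<in>{0<..<\<epsilon>}. \<gamma> s + r *\<^sub>R N (\<gamma> s) \<in> outside \<Gamma>))"

definition tube_map :: "(real \<Rightarrow> real^2) \<Rightarrow> (real^2 \<Rightarrow> real^2) \<Rightarrow> real \<times> real \<Rightarrow> real^2" where
  "tube_map \<gamma> N = (\<lambda>(s, r). \<gamma> s + r *\<^sub>R N (\<gamma> s))"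

definition tube_dom :: "real \<Rightarrow> real \<Rightarrow> (real \<times> real) set" where
  "tube_dom L \<rho> = {0..<L} \<times> {-\<rho><..<\<rho>}"

definition tube :: "(real \<Rightarrow> real^2) \<Rightarrow> real \<Rightarrow> (real^2 \<Rightarrow> real^2) \<Rightarrow> real \<Rightarrow> (real^2) set" where
  "tube \<gamma> L N \<rho> = tube_map \<gamma> N ` tube_dom L \<rho>"

text \<open>Both \<open>\<gamma>'\<close> and the derivative of \<open>N \<circ> \<gamma>\<close> are tangential, so the third condition says that
  the Jacobian of \<open>tube_map\<close> does not vanish. The last one says that \<open>N\<close>
  is extended to the tubular neighborhood as constant along normals.\<close>

definition tubular_coords :: "(real \<Rightarrow> real^2) \<Rightarrow> real \<Rightarrow> (real^2 \<Rightarrow> real^2) \<Rightarrow> real \<Rightarrow> bool" where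
  "tubular_coords \<gamma> L N \<rho> \<longleftrightarrow> 0 < \<rho> \<and> inj_on (tube_map \<gamma> N) (tube_dom L \<rho>) \<and>
     (\<forall>s. \<forall>r\<in>{-\<rho><..<\<rho>}.
        vector_derivative \<gamma> (at s) + r *\<^sub>R vector_derivative (\<lambda>\<sigma>. N (\<gamma> \<sigma>)) (at s) \<noteq> 0) \<and>
     (\<forall>s. \<forall>r\<in>{-\<rho><..<\<rho>}. N (tube_map \<gamma> N (s, r)) = N (\<gamma> s))"

definition normal_cutoff ::
    "(real^2) set \<Rightarrow> (real \<Rightarrow> real^2) \<Rightarrow> real \<Rightarrow> (real^2 \<Rightarrow> real^2) \<Rightarrow> real \<Rightarrow> (real^2 \<Rightarrow> real) \<Rightarrow> bool" where
  "normal_cutoff \<Gamma> \<gamma> L N \<rho> \<chi>\<^sub>b \<longleftrightarrow> smooth_on UNIV \<chi>\<^sub>b \<and>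
     closure {x. \<chi>\<^sub>b x \<noteq> 0} \<subseteq> tube \<gamma> L N \<rho> \<and>
     (\<exists>\<eta>. \<forall>(s, r)\<in>tube_dom L \<rho>. \<chi>\<^sub>b (tube_map \<gamma> N (s, r)) = \<eta> r) \<and>
     (\<exists>V. open V \<and> \<Gamma> \<subseteq> V \<and> (\<forall>x\<in>V. \<chi>\<^sub>b x = 1))"

text \<open>The derivative with respect to \<open>s\<close> at fixed \<open>r\<close>; meaningful on \<open>tube \<gamma> L N \<rho>\<close> only. Since
  \<open>r = 0\<close> on \<open>\<Gamma>\<close>, it is also the arc length derivative of functions defined on \<open>\<Gamma>\<close>.\<close>

definition tube_coord :: "(real \<Rightarrow> real^2) \<Rightarrow> real \<Rightarrow> (real^2 \<Rightarrow> real^2) \<Rightarrow> real \<Rightarrow> real^2 \<Rightarrow> real \<times> real" where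
  "tube_coord \<gamma> L N \<rho> = inv_into (tube_dom L \<rho>) (tube_map \<gamma> N)"

definition d_tan ::
    "(real \<Rightarrow> real^2) \<Rightarrow> real \<Rightarrow> (real^2 \<Rightarrow> real^2) \<Rightarrow> real \<Rightarrow>
     (real^2 \<Rightarrow> 'b::real_normed_vector) \<Rightarrow> real^2 \<Rightarrow> 'b" where
  "d_tan \<gamma> L N \<rho> f x = (let (s, r) = tube_coord \<gamma> L N \<rho> x in
     vector_derivative (\<lambda>\<sigma>. f (tube_map \<gamma> N (\<sigma>, r))) (at s))"

definition tan_differentiable ::
    "(real \<Rightarrow> real^2) \<Rightarrow> real \<Rightarrow> (real^2 \<Rightarrow> real^2) \<Rightarrow> real \<Rightarrow>
     (real^2 \<Rightarrow> 'b::real_normed_vector) \<Rightarrow> real^2 \<Rightarrow> bool" where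
  "tan_differentiable \<gamma> L N \<rho> f x \<longleftrightarrow> (let (s, r) = tube_coord \<gamma> L N \<rho> x in
     (\<lambda>\<sigma>. f (tube_map \<gamma> N (\<sigma>, r))) differentiable (at s))"

datatype direction = Time | Tan

fun d_par ::
    "direction \<Rightarrow> (real \<Rightarrow> real^2) \<Rightarrow> real \<Rightarrow> (real^2 \<Rightarrow> real^2) \<Rightarrow> real \<Rightarrow>
     (real \<Rightarrow> real^2 \<Rightarrow> 'b::real_normed_vector) \<Rightarrow> real \<Rightarrow> real^2 \<Rightarrow> 'b" where
  "d_par Time \<gamma> L N \<rho> f t x = dt f t x"
| "d_par Tan \<gamma> L N \<rho> f t x = d_tan \<gamma> L N \<rho> (f t) x"

fun par_differentiable ::
    "direction \<Rightarrow> (real \<Rightarrow> real^2) \<Rightarrow> real \<Rightarrow> (real^2 \<Rightarrow> real^2) \<Rightarrow> real \<Rightarrow>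
     (real \<Rightarrow> real^2 \<Rightarrow> 'b::real_normed_vector) \<Rightarrow> real \<Rightarrow> real^2 \<Rightarrow> bool" where
  "par_differentiable Time \<gamma> L N \<rho> f t x \<longleftrightarrow> (\<lambda>\<tau>. f \<tau> x) differentiable (at t)"
| "par_differentiable Tan \<gamma> L N \<rho> f t x \<longleftrightarrow> tan_differentiable \<gamma> L N \<rho> (f t) x"


section \<open>Block notation in dimension 1 + 2\<close>

definition compI :: "real^3 \<Rightarrow> real" where
  "compI w = w $ 1"

definition compII :: "real^3 \<Rightarrow> real^2" where
  "compII w = vector [w $ 2, w $ 3]"

definition block_vec :: "real \<Rightarrow> real^2 \<Rightarrow> real^3" where
  "block_vec a b = vector [a, b $ 1, b $ 2]"

text \<open>\<open>block_mat a b c D\<close> has the first row \<open>(a, b\<^sup>T)\<close> and the first column \<open>(a, c\<^sup>T)\<^sup>T\<close>.\<close>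

definition block_mat :: "real \<Rightarrow> real^2 \<Rightarrow> real^2 \<Rightarrow> real^2^2 \<Rightarrow> real^3^3" where
  "block_mat a b c D = vector [block_vec a b, block_vec (c $ 1) (D $ 1), block_vec (c $ 2) (D $ 2)]"

definition outer :: "real^2 \<Rightarrow> real^2 \<Rightarrow> real^2^2" where
  "outer a b = (\<chi> i k. a $ i * b $ k)"


section \<open>Fluxes and symmetrizer\<close>

abbreviation (input) surf :: "real^3 \<Rightarrow> real" where
  "surf w \<equiv> compI w"

abbreviation (input) vel :: "real^3 \<Rightarrow> real^2" where
  "vel w \<equiv> compII w"

abbreviation (input) height :: "real \<Rightarrow> real^3 \<Rightarrow> real" where
  "height H0 w \<equiv> H0 + surf w"

definition flux :: "real \<Rightarrow> real \<Rightarrow> 2 \<Rightarrow> real^3 \<Rightarrow> real^3" where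
  "flux g H0 j w =
     block_vec (height H0 w * vel w $ j) ((g * surf w + (norm (vel w))\<^sup>2 / 2) *\<^sub>R axis j 1)"

definition A_mat :: "real \<Rightarrow> real \<Rightarrow> 2 \<Rightarrow> real^3 \<Rightarrow> real^3^3" where
  "A_mat g H0 j w =
     block_mat (vel w $ j) (height H0 w *\<^sub>R axis j 1) (g *\<^sub>R axis j 1) (outer (axis j 1) (vel w))"

lemma flux_has_derivative: "(flux g H0 j has_derivative (\<lambda>k. A_mat g H0 j w *v k)) (at w)"
proof -
  have j: "j = 1 \<or> j = 2"
    using exhaust_2 by blast
  have nth: "((\<lambda>v :: real^3. v $ m) has_derivative (\<lambda>k. k $ m)) (at w)" for m
    by (rule bounded_linear_imp_has_derivative[OF bounded_linear_vec_nth])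
  have "((\<lambda>v. flux g H0 j v $ i) has_derivative (\<lambda>k. (A_mat g H0 j w *v k) $ i)) (at w)" for i
    using j exhaust_3[of i]
    by (elim disjE; simp add: flux_def A_mat_def block_mat_def block_vec_def compI_def compII_def
        outer_def axis_def matrix_vector_mult_def sum_3 norm_vec_def L2_set_def sum_2)
      (auto intro!: derivative_eq_intros nth simp: algebra_simps)
  then show ?thesis
    by (subst has_derivative_componentwise_within)
      (auto simp: Basis_vec_def inner_axis)
qed

corollary jacobian_flux: "jacobian (flux g H0 j) (at w) = A_mat g H0 j w"
  unfolding jacobian_def frechet_derivative_at[OF flux_has_derivative, symmetric]
  by (rule matrix_of_matrix_vector_mul)

definition flux_nor :: "real \<Rightarrow> real \<Rightarrow> real^2 \<Rightarrow> real^3 \<Rightarrow> real^3" where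
  "flux_nor g H0 n w = (\<Sum>j\<in>UNIV. n $ j *\<^sub>R flux g H0 j w)"

definition A_nor :: "real \<Rightarrow> real \<Rightarrow> real^2 \<Rightarrow> real^3 \<Rightarrow> real^3^3" where
  "A_nor g H0 n w = (\<Sum>j\<in>UNIV. n $ j *\<^sub>R A_mat g H0 j w)"

definition G_mat :: "2 \<Rightarrow> real^3^3" where
  "G_mat j = block_mat 0 (axis j 1) (axis j 1) 0"

definition Sigma_mat :: "real \<Rightarrow> real \<Rightarrow> real^3 \<Rightarrow> real^3^3" where
  "Sigma_mat g H0 w = block_mat g (vel w) (vel w) (height H0 w *\<^sub>R mat 1)"

definition B_mat :: "real \<Rightarrow> real \<Rightarrow> (real \<Rightarrow> real^2 \<Rightarrow> real^3) \<Rightarrow> real \<Rightarrow> real^2 \<Rightarrow> real^3^3" where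
  "B_mat g H0 u t x = Sigma_mat g H0 (u t x) ** dt (\<lambda>\<tau> y. matrix_inv (Sigma_mat g H0 (u \<tau> y))) t x"


section \<open>The Dirichlet-to-Neumann map\<close>

definition elliptic_extension ::
    "(real^2) set \<Rightarrow> (real^2 \<Rightarrow> real) \<Rightarrow> (real^2 \<Rightarrow> real) \<Rightarrow> (real^2 \<Rightarrow> real) \<Rightarrow> bool" where
  "elliptic_extension \<Gamma> hi \<psi> \<phi> \<longleftrightarrow>
     Ck_on 2 (inside \<Gamma>) \<phi> \<and> Ck_closure 1 (inside \<Gamma>) \<phi> \<and>
     (\<forall>x\<in>inside \<Gamma>. div2 (\<lambda>y. hi y *\<^sub>R grad \<phi> y) x = 0) \<and>
     (\<forall>x\<in>\<Gamma>. \<phi> x = \<psi> x)"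

definition DN_domain :: "(real^2) set \<Rightarrow> (real^2 \<Rightarrow> real) \<Rightarrow> (real^2 \<Rightarrow> real) \<Rightarrow> bool" where
  "DN_domain \<Gamma> hi \<psi> \<longleftrightarrow> (\<exists>\<phi>. elliptic_extension \<Gamma> hi \<psi> \<phi>)"

text \<open>For \<open>\<psi>\<close> in \<open>DN_domain\<close> the extension is unique on the closure of the interior by the maximum
  principle. The limit is the trace on \<open>\<Gamma>\<close> from the interior.\<close>

definition DN_map ::
    "(real^2) set \<Rightarrow> (real^2 \<Rightarrow> real^2) \<Rightarrow> (real^2 \<Rightarrow> real) \<Rightarrow> (real^2 \<Rightarrow> real) \<Rightarrow> real^2 \<Rightarrow> real" where
  "DN_map \<Gamma> N hi \<psi> x = (let \<phi> = (SOME \<phi>. elliptic_extension \<Gamma> hi \<psi> \<phi>) in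
     N x \<bullet> Lim (at x within inside \<Gamma>) (\<lambda>y. hi y *\<^sub>R grad \<phi> y))"


section \<open>Source terms\<close>

text \<open>\<open>f_dot = - [\<chi>\<^sub>b d_par, d_j] F_j(u)\<close> with \<open>[P, Q] = P Q - Q P\<close>. Where \<open>\<chi>\<^sub>b\<close> vanishes, so does the
  product \<open>\<chi>\<^sub>b d_par\<close>, whatever the value of \<open>d_par\<close> outside the tubular neighborhood.\<close>

definition f_dot ::
    "direction \<Rightarrow> (real \<Rightarrow> real^2) \<Rightarrow> real \<Rightarrow> (real^2 \<Rightarrow> real^2) \<Rightarrow> real \<Rightarrow> (real^2 \<Rightarrow> real) \<Rightarrow>
     real \<Rightarrow> real \<Rightarrow> (real \<Rightarrow> real^2 \<Rightarrow> real^3) \<Rightarrow> real \<Rightarrow> real^2 \<Rightarrow> real^3" where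
  "f_dot d \<gamma> L N \<rho> \<chi>\<^sub>b g H0 u t x =
     - (\<Sum>j\<in>UNIV.
          \<chi>\<^sub>b x *\<^sub>R d_par d \<gamma> L N \<rho> (\<lambda>\<tau>. dx j (\<lambda>y. flux g H0 j (u \<tau> y))) t x
          - dx j (\<lambda>y. \<chi>\<^sub>b y *\<^sub>R d_par d \<gamma> L N \<rho> (\<lambda>\<tau> z. flux g H0 j (u \<tau> z)) t y) x)"

definition g1_src ::
    "direction \<Rightarrow> (real^2) set \<Rightarrow> (real \<Rightarrow> real^2) \<Rightarrow> real \<Rightarrow> (real^2 \<Rightarrow> real^2) \<Rightarrow> real \<Rightarrow>
     (real^2 \<Rightarrow> real) \<Rightarrow> (real \<Rightarrow> real^2 \<Rightarrow> real) \<Rightarrow> real \<Rightarrow> real^2 \<Rightarrow> real" where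
  "g1_src d \<Gamma> \<gamma> L N \<rho> hi \<psi> t x =
     d_par d \<gamma> L N \<rho> (\<lambda>\<tau>. DN_map \<Gamma> N hi (\<psi> \<tau>)) t x
     - DN_map \<Gamma> N hi (d_par d \<gamma> L N \<rho> \<psi> t) x"

definition g2_src ::
    "direction \<Rightarrow> (real \<Rightarrow> real^2) \<Rightarrow> real \<Rightarrow> (real^2 \<Rightarrow> real^2) \<Rightarrow> real \<Rightarrow>
     real \<Rightarrow> real \<Rightarrow> (real \<Rightarrow> real^2 \<Rightarrow> real^3) \<Rightarrow> real \<Rightarrow> real^2 \<Rightarrow> real" where
  "g2_src d \<gamma> L N \<rho> g H0 u t x =
     - (d_par d \<gamma> L N \<rho> (\<lambda>\<tau>. N) t x \<bullet> compII (flux_nor g H0 (N x) (u t x)))"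


section \<open>Regularity of the unknowns and of the given state\<close>

text \<open>The classical regularity used for the unknowns: \<open>C\<^sup>1\<close> in the open set \<open>(0,T) \<times> \<E>\<close> and continuous
  up to \<open>\<Gamma>\<close> for the exterior unknown; differentiable in time and with a classical Dirichlet-to-Neumann
  image at every time for the boundary unknown.\<close>

definition regular_pair ::
    "real \<Rightarrow> (real^2) set \<Rightarrow> (real^2 \<Rightarrow> real) \<Rightarrow>
     (real \<Rightarrow> real^2 \<Rightarrow> real^3) \<Rightarrow> (real \<Rightarrow> real^2 \<Rightarrow> real) \<Rightarrow> bool" where
  "regular_pair T \<Gamma> hi w \<psi> \<longleftrightarrow>
     Ck_on 1 ({0<..<T} \<times> outside \<Gamma>) (\<lambda>(t, x). w t x) \<and>
     continuous_on ({0<..<T} \<times> closure (outside \<Gamma>)) (\<lambda>(t, x). w t x) \<and>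
     (\<forall>t\<in>{0<..<T}. DN_domain \<Gamma> hi (\<psi> t) \<and> (\<forall>x\<in>\<Gamma>. (\<lambda>\<tau>. \<psi> \<tau> x) differentiable (at t)))"

text \<open>Regularity of the given \<open>(u, \<psi>)\<close> that makes all source terms classically meaningful.\<close>

definition regular_state ::
    "direction \<Rightarrow> real \<Rightarrow> (real^2) set \<Rightarrow> (real \<Rightarrow> real^2) \<Rightarrow> real \<Rightarrow> (real^2 \<Rightarrow> real^2) \<Rightarrow> real \<Rightarrow>
     (real^2 \<Rightarrow> real) \<Rightarrow> (real \<Rightarrow> real^2 \<Rightarrow> real^3) \<Rightarrow> (real \<Rightarrow> real^2 \<Rightarrow> real) \<Rightarrow> bool" where
  "regular_state d T \<Gamma> \<gamma> L N \<rho> hi u \<psi> \<longleftrightarrow>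
     Ck_on 2 ({0<..<T} \<times> outside \<Gamma>) (\<lambda>(t, x). u t x) \<and>
     continuous_on ({0<..<T} \<times> closure (outside \<Gamma>)) (\<lambda>(t, x). u t x) \<and>
     (\<forall>t\<in>{0<..<T}. DN_domain \<Gamma> hi (\<psi> t) \<and> DN_domain \<Gamma> hi (d_par d \<gamma> L N \<rho> \<psi> t) \<and>
        (\<forall>x\<in>\<Gamma>. par_differentiable d \<gamma> L N \<rho> \<psi> t x \<and>
               par_differentiable d \<gamma> L N \<rho> (\<lambda>\<tau>. DN_map \<Gamma> N hi (\<psi> \<tau>)) t x))"

end

theory Submission
  imports Defs
begin

text \<open>
  The system is symmetrized by the factorization \<open>A\<^sub>j(u) = G\<^sub>j \<Sigma>(u)\<close> with constant \<open>G\<^sub>j\<close>: the flux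
  derivative becomes \<open>G\<^sub>j \<partial>\<^sub>j (\<Sigma>(u) u_dot)\<close>, and multiplying the equation by the invertible matrix
  \<open>\<Sigma>(u)\<close> leaves \<open>\<Sigma>(u) \<partial>\<^sub>t (\<Sigma>(u)\<^sup>-\<^sup>1 u_check) = \<partial>\<^sub>t u_check + B u_check\<close>. The determinant of \<open>\<Sigma>(u)\<close> is
  \<open>h (g h - |v|\<^sup>2)\<close>; its bound from below extends to the closed exterior by continuity, so that
  \<open>u_dot\<close> and \<open>u_check\<close> have the same regularity. By Cramer's rule the inverse of a \<open>C\<^sup>1\<close> family of
  invertible matrices is \<open>C\<^sup>1\<close>.
\<close>

section \<open>Continuously differentiable functions\<close>

text \<open>\<open>Ck_on\<close> tests the derivative in basis directions only; linearity of the
  derivative gives continuity in every direction. With an arbitrary \<open>f'\<close> on the right,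
  it suffices to exhibit a derivative instead of computing
  \<open>frechet_derivative\<close>.\<close>

lemma Ck_on_1_iff:
  fixes f :: "'a::euclidean_space \<Rightarrow> 'b::real_normed_vector"
  assumes "open S"
  shows "Ck_on 1 S f \<longleftrightarrow>
    (\<exists>f'. (\<forall>x\<in>S. (f has_derivative f' x) (at x)) \<and> (\<forall>v. continuous_on S (\<lambda>x. f' x v)))"
proof
  assume f: "Ck_on 1 S f"
  let ?f' = "\<lambda>x. frechet_derivative f (at x)"
  have D: "(f has_derivative ?f' x) (at x)" if "x \<in> S" for x
    using f that assms frechet_derivative_works
    by (auto simp: differentiable_on_eq_differentiable_at)
  have "continuous_on S (\<lambda>x. ?f' x v)" for v
  proof -
    have "continuous_on S (\<lambda>x. \<Sum>b\<in>Basis. (v \<bullet> b) *\<^sub>R ?f' x b)"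
      using f by (auto intro!: continuous_intros)
    moreover have "?f' x v = (\<Sum>b\<in>Basis. (v \<bullet> b) *\<^sub>R ?f' x b)" if "x \<in> S" for x
    proof -
      interpret linear "?f' x"
        using D[OF that] by (rule has_derivative_linear)
      have "?f' x v = ?f' x (\<Sum>b\<in>Basis. (v \<bullet> b) *\<^sub>R b)"
        by (simp add: euclidean_representation)
      then show ?thesis
        by (simp add: sum scaleR)
    qed
    ultimately show ?thesis
      by (simp cong: continuous_on_cong)
  qed
  with D show "\<exists>f'. (\<forall>x\<in>S. (f has_derivative f' x) (at x)) \<and> (\<forall>v. continuous_on S (\<lambda>x. f' x v))"
    by (intro exI[of _ ?f']) auto
next
  assume "\<exists>f'. (\<forall>x\<in>S. (f has_derivative f' x) (at x)) \<and> (\<forall>v. continuous_on S (\<lambda>x. f' x v))"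
  then obtain f' where D: "\<And>x. x \<in> S \<Longrightarrow> (f has_derivative f' x) (at x)"
    and c: "\<And>v. continuous_on S (\<lambda>x. f' x v)"
    by blast
  have "continuous_on S (\<lambda>x. frechet_derivative f (at x) b)" for b
    using c[of b] by (rule continuous_on_eq) (simp add: frechet_derivative_at[OF D, symmetric])
  moreover have "f differentiable_on S"
    using D assms by (auto simp: differentiable_on_eq_differentiable_at differentiable_def)
  ultimately show "Ck_on 1 S f"
    by simp
qed

lemma Ck_on_1I:
  fixes f :: "'a::euclidean_space \<Rightarrow> 'b::real_normed_vector"
  assumes "open S" "\<And>x. x \<in> S \<Longrightarrow> (f has_derivative f' x) (at x)"
    "\<And>v. continuous_on S (\<lambda>x. f' x v)"
  shows "Ck_on 1 S f"
  using assms Ck_on_1_iff by blast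

lemma Ck_on_1_imp_differentiable:
  "open S \<Longrightarrow> Ck_on 1 S f \<Longrightarrow> x \<in> S \<Longrightarrow> f differentiable (at x)"
  by (auto simp: differentiable_on_eq_differentiable_at)

lemma Ck_on_1_imp_continuous_on: "Ck_on 1 S f \<Longrightarrow> continuous_on S f"
  by (simp add: differentiable_imp_continuous_on)

lemma Ck_on_2_imp_Ck_on_1: "Ck_on 2 S f \<Longrightarrow> Ck_on 1 S f"
  by (auto simp: numeral_2_eq_2 intro: differentiable_imp_continuous_on)

text \<open>On an open set, agreement of the values forces agreement of the derivatives. This allows
  formulas valid only on \<open>S\<close>, such as Cramer's rule below, to be exchanged.\<close>

lemma Ck_on_1_cong:
  fixes f h :: "'a::euclidean_space \<Rightarrow> 'b::real_normed_vector"
  assumes S: "open S" and f: "Ck_on 1 S f" and eq: "\<And>x. x \<in> S \<Longrightarrow> f x = h x"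
  shows "Ck_on 1 S h"
proof -
  obtain f' where D: "\<And>x. x \<in> S \<Longrightarrow> (f has_derivative f' x) (at x)"
    and c: "\<And>v. continuous_on S (\<lambda>x. f' x v)"
    using f Ck_on_1_iff[OF S] by blast
  have "(h has_derivative f' x) (at x)" if "x \<in> S" for x
    by (rule has_derivative_transform_within_open[OF D S]) (use that eq in auto)
  with S c show ?thesis
    by (intro Ck_on_1I)
qed

section \<open>Closure of the class of C^1 functions under algebraic operations\<close>

lemma Ck_on_1_const: "open S \<Longrightarrow> Ck_on 1 S (\<lambda>x. c)"
  by (rule Ck_on_1I[where f' = "\<lambda>_ _. 0"]) auto

lemma Ck_on_1_add:
  fixes f h :: "'a::euclidean_space \<Rightarrow> 'b::real_normed_vector"
  assumes S: "open S" and f: "Ck_on 1 S f" and h: "Ck_on 1 S h"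
  shows "Ck_on 1 S (\<lambda>x. f x + h x)"
proof -
  obtain f' where f': "\<And>x. x \<in> S \<Longrightarrow> (f has_derivative f' x) (at x)"
    "\<And>v. continuous_on S (\<lambda>x. f' x v)"
    using f Ck_on_1_iff[OF S] by blast
  obtain h' where h': "\<And>x. x \<in> S \<Longrightarrow> (h has_derivative h' x) (at x)"
    "\<And>v. continuous_on S (\<lambda>x. h' x v)"
    using h Ck_on_1_iff[OF S] by blast
  from S f' h' show ?thesis
    by (intro Ck_on_1I[where f' = "\<lambda>x v. f' x v + h' x v"])
      (auto intro!: has_derivative_add continuous_intros)
qed

text \<open>The product rule in the generality that covers both real products and matrix-vector
  products.\<close>

lemma Ck_on_1_bilinear:
  fixes f :: "'a::euclidean_space \<Rightarrow> 'b::real_normed_vector"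
    and h :: "'a \<Rightarrow> 'c::real_normed_vector"
  assumes S: "open S" and "bounded_bilinear B" and f: "Ck_on 1 S f" and h: "Ck_on 1 S h"
  shows "Ck_on 1 S (\<lambda>x. B (f x) (h x))"
proof -
  interpret bounded_bilinear B by fact
  have c: "continuous_on S f" "continuous_on S h"
    using assms by (auto intro: Ck_on_1_imp_continuous_on)
  obtain f' where f': "\<And>x. x \<in> S \<Longrightarrow> (f has_derivative f' x) (at x)"
    "\<And>v. continuous_on S (\<lambda>x. f' x v)"
    using f Ck_on_1_iff[OF S] by blast
  obtain h' where h': "\<And>x. x \<in> S \<Longrightarrow> (h has_derivative h' x) (at x)"
    "\<And>v. continuous_on S (\<lambda>x. h' x v)"
    using h Ck_on_1_iff[OF S] by blast
  from S c f' h' show ?thesis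
    by (intro Ck_on_1I[where f' = "\<lambda>x v. B (f x) (h' x v) + B (f' x v) (h x)"])
      (auto intro!: FDERIV continuous_on continuous_on_add)
qed

lemma Ck_on_1_bounded_linear:
  fixes f :: "'a::euclidean_space \<Rightarrow> 'b::real_normed_vector"
  assumes S: "open S" and "bounded_linear F" and f: "Ck_on 1 S f"
  shows "Ck_on 1 S (\<lambda>x. F (f x))"
proof -
  interpret bounded_linear F by fact
  obtain f' where f': "\<And>x. x \<in> S \<Longrightarrow> (f has_derivative f' x) (at x)"
    "\<And>v. continuous_on S (\<lambda>x. f' x v)"
    using f Ck_on_1_iff[OF S] by blast
  from S f' show ?thesis
    by (intro Ck_on_1I[where f' = "\<lambda>x v. F (f' x v)"]) (auto intro!: has_derivative continuous_on)
qed

lemma Ck_on_1_sum: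
  fixes f :: "'i \<Rightarrow> 'a::euclidean_space \<Rightarrow> 'b::real_normed_vector"
  assumes "open S" "\<And>i. i \<in> I \<Longrightarrow> Ck_on 1 S (f i)"
  shows "Ck_on 1 S (\<lambda>x. \<Sum>i\<in>I. f i x)"
  using assms(2)
  by (induction I rule: infinite_finite_induct)
    (auto simp del: One_nat_def intro!: Ck_on_1_const Ck_on_1_add assms(1))

lemmas Ck_on_1_mult = Ck_on_1_bilinear[OF _ bounded_bilinear_mult]

lemma Ck_on_1_prod:
  fixes f :: "'i \<Rightarrow> 'a::euclidean_space \<Rightarrow> real"
  assumes "open S" "\<And>i. i \<in> I \<Longrightarrow> Ck_on 1 S (f i)"
  shows "Ck_on 1 S (\<lambda>x. \<Prod>i\<in>I. f i x)"
  using assms(2)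
  by (induction I rule: infinite_finite_induct)
    (auto simp del: One_nat_def intro!: Ck_on_1_const Ck_on_1_mult assms(1))

lemma Ck_on_1_inverse:
  fixes f :: "'a::euclidean_space \<Rightarrow> real"
  assumes S: "open S" and f: "Ck_on 1 S f" and nz: "\<And>x. x \<in> S \<Longrightarrow> f x \<noteq> 0"
  shows "Ck_on 1 S (\<lambda>x. inverse (f x))"
proof -
  have "continuous_on S f"
    using assms by (auto intro: Ck_on_1_imp_continuous_on)
  moreover obtain f' where  "\<And>x. x \<in> S \<Longrightarrow> (f has_derivative f' x) (at x)"
    "\<And>v. continuous_on S (\<lambda>x. f' x v)"
    using f Ck_on_1_iff[OF S] by blast
  ultimately show ?thesis using S nz
    by (intro Ck_on_1I[where f' = "\<lambda>x v. - (inverse (f x) * f' x v * inverse (f x))"])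
      (auto intro!: has_derivative_inverse continuous_intros)
qed

text \<open>The entries may themselves be vectors, so two applications reduce a matrix to its scalar
  entries.\<close>

lemma Ck_on_1_vec:
  fixes f :: "'a::euclidean_space \<Rightarrow> 'b::euclidean_space^'n"
  assumes S: "open S" and f: "\<And>i. Ck_on 1 S (\<lambda>x. f x $ i)"
  shows "Ck_on 1 S f"
proof -
  have "\<exists>D. (\<forall>x\<in>S. ((\<lambda>x. f x $ i) has_derivative D x) (at x)) \<and>
      (\<forall>v. continuous_on S (\<lambda>x. D x v))" for i
    using f[of i] Ck_on_1_iff[OF S] by blast
  then obtain D where "\<And>i x. x \<in> S \<Longrightarrow> ((\<lambda>x. f x $ i) has_derivative D i x) (at x)"
    and c: "\<And>i v. continuous_on S (\<lambda>x. D i x v)"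
    by metis
  then have "(f has_derivative (\<lambda>v. \<chi> i. D i x v)) (at x)" if "x \<in> S" for x
    using that by (subst has_derivative_componentwise_within)
      (auto simp: Basis_vec_def inner_axis intro!: has_derivative_inner_left)
  with S c show ?thesis
    by (intro Ck_on_1I[where f' = "\<lambda>x v. \<chi> i. D i x v"]) (auto intro!: continuous_intros)
qed

lemmas Ck_on_1_vec_nth = Ck_on_1_bounded_linear[OF _ bounded_linear_vec_nth]

section \<open>Matrix-valued functions\<close>

lemma bounded_bilinear_matrix_vector_mult:
  "bounded_bilinear (\<lambda>(A :: real^'n^'m) x. A *v x)"
  unfolding bilinear_conv_bounded_bilinear[symmetric] bilinear_def
  by (auto intro!: linearI simp: matrix_vector_mult_add_rdistrib matrix_vector_right_distrib
      scaleR_matrix_vector_assoc matrix_vector_mult_scaleR)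

lemma continuous_on_det:
  fixes A :: "'a::topological_space \<Rightarrow> real^'n^'n"
  assumes "continuous_on S A"
  shows "continuous_on S (\<lambda>x. det (A x))"
  unfolding det_def by (intro continuous_intros assms)

text \<open>By the Leibniz formula the determinant is a polynomial in the entries.\<close>

lemma Ck_on_1_det:
  fixes A :: "'a::euclidean_space \<Rightarrow> real^'n^'n"
  assumes "open S" "Ck_on 1 S A"
  shows "Ck_on 1 S (\<lambda>x. det (A x))"
  unfolding det_def
  by (intro Ck_on_1_sum Ck_on_1_mult Ck_on_1_const Ck_on_1_prod Ck_on_1_vec_nth assms)

text \<open>\<open>matrix_inv\<close> is a Hilbert choice; invertibility provides the witness that
  makes the choice meaningful.\<close>

lemma matrix_inv:
  assumes "invertible A"
  shows "A ** matrix_inv A = mat 1" "matrix_inv A ** A = mat 1"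
  using someI_ex[OF assms[unfolded invertible_def]] by (auto simp: matrix_inv_def)

text \<open>Column \<open>k\<close> of the inverse solves the linear system whose right-hand side is
  the \<open>k\<close>-th unit vector, and Cramer's rule solves that system. The formula involves
  only determinants and one scalar reciprocal, so regularity of the inverse can be read off from
  it.\<close>

lemma matrix_inv_cramer:
  fixes A :: "real^'n^'n"
  assumes "invertible A"
  shows "matrix_inv A =
    (\<chi> i k. det (\<chi> r c. if c = i then mat 1 $ r $ k else A $ r $ c) * inverse (det A))"
proof -
  have "matrix_inv A $ i $ k
      = det (\<chi> r c. if c = i then mat 1 $ r $ k else A $ r $ c) * inverse (det A)" for i k
  proof -
    have "A *v column k (matrix_inv A) = column k (mat 1)"
      using matrix_inv(1)[OF assms]
      by (metis column_def matrix_vector_mult_basis matrix_vector_mul_assoc)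
    moreover have "det A \<noteq> 0"
      using assms by (simp add: invertible_det_nz)
    ultimately have "column k (matrix_inv A)
        = (\<chi> i. det (\<chi> r c. if c = i then column k (mat 1) $ r else A $ r $ c) / det A)"
      using cramer by blast
    then show ?thesis
      by (simp add: column_def vec_eq_iff divide_inverse cong: if_cong)
  qed
  then show ?thesis
    by (simp add: vec_eq_iff)
qed

lemma continuous_on_matrix_inv:
  fixes A :: "'a::topological_space \<Rightarrow> real^'n^'n"
  assumes A: "continuous_on S A" and inv: "\<And>x. x \<in> S \<Longrightarrow> invertible (A x)"
  shows "continuous_on S (\<lambda>x. matrix_inv (A x))"
proof -
  \<comment> \<open>The replaced column is constant in \<open>x\<close>; every other entry is an
    entry of \<open>A x\<close>.\<close>
  have "continuous_on S (\<lambda>x. if c = i then mat 1 $ r $ k else A x $ r $ c)" for i k r c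
    using A by (cases "c = i") (auto intro!: continuous_intros)
  then have "continuous_on S (\<lambda>x. \<chi> i k.
      det (\<chi> r c. if c = i then mat 1 $ r $ k else A x $ r $ c) * inverse (det (A x)))"
    using A inv by (intro continuous_intros continuous_on_det) (auto simp: invertible_det_nz)
  then show ?thesis
    by (rule continuous_on_eq) (simp add: matrix_inv_cramer inv)
qed

lemma Ck_on_1_matrix_inv:
  fixes A :: "'a::euclidean_space \<Rightarrow> real^'n^'n"
  assumes S: "open S" and A: "Ck_on 1 S A" and inv: "\<And>x. x \<in> S \<Longrightarrow> invertible (A x)"
  shows "Ck_on 1 S (\<lambda>x. matrix_inv (A x))"
proof -
  have "Ck_on 1 S (\<lambda>x. if c = i then mat 1 $ r $ k else A x $ r $ c)" for i k r c
    using A S by (cases "c = i") (auto simp del: One_nat_def intro!: Ck_on_1_const Ck_on_1_vec_nth)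
  then have C: "Ck_on 1 S (\<lambda>x. det (\<chi> r c. if c = i then mat 1 $ r $ k else A x $ r $ c)
      * inverse (det (A x)))" for i k
    using S A inv by (intro Ck_on_1_mult Ck_on_1_inverse Ck_on_1_det)
      (auto simp del: One_nat_def simp: invertible_det_nz intro!: Ck_on_1_vec)
  have "Ck_on 1 S (\<lambda>x. matrix_inv (A x) $ i $ k)" for i k
    by (rule Ck_on_1_cong[OF S C[of i k]]) (simp add: matrix_inv_cramer inv)
  then show ?thesis
    by (intro Ck_on_1_vec S)
qed

section \<open>The symmetrizer\<close>

text \<open>Let E = g zeta^2 / 2 + h |v|^2 / 2 be the energy density. The flux is
  \<open>G_mat j\<close> applied to the gradient of E, and \<open>Sigma_mat\<close> is the Hessian
  of E, so differentiating the flux gives this factorization.\<close>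

lemma A_mat_eq: "A_mat g H0 j w = G_mat j ** Sigma_mat g H0 w"
proof -
  have "j = 1 \<or> j = 2"
    using exhaust_2 by blast
  then show ?thesis
    by (auto simp: A_mat_def G_mat_def Sigma_mat_def block_mat_def block_vec_def compI_def
        compII_def outer_def axis_def mat_def matrix_matrix_mult_def vec_eq_iff sum_3 forall_3)
qed

lemma G_mat_mult:
  "G_mat j *v k = block_vec (compII k $ j) (compI k *\<^sub>R axis j 1)"
proof -
  have "j = 1 \<or> j = 2"
    using exhaust_2 by blast
  then show ?thesis
    by (auto simp: G_mat_def block_mat_def block_vec_def compI_def compII_def axis_def
        matrix_vector_mult_def vec_eq_iff sum_3 forall_3)
qed

lemma A_nor_mult:
  "A_nor g H0 n w *v k = (\<Sum>j\<in>UNIV. n $ j *\<^sub>R (G_mat j *v (Sigma_mat g H0 w *v k)))"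
  by (simp only: A_nor_def A_mat_eq sum_2 matrix_vector_mult_add_rdistrib
      scaleR_matrix_vector_assoc matrix_vector_mul_assoc)

text \<open>\<open>G_mat j\<close> exchanges the scalar and the vector block, which is why the first
  component of the normal flux sees the vector part of the new unknown.\<close>

lemma compI_A_nor: "compI (A_nor g H0 n w *v k) = n \<bullet> compII (Sigma_mat g H0 w *v k)"
  unfolding A_nor_mult G_mat_mult
  by (simp add: compI_def block_vec_def sum_2 inner_vec_def)

text \<open>The same exchange makes the vector part of the normal flux purely normal; pairing it
  with a unit \<open>n\<close> recovers the scalar part of the new unknown.\<close>

lemma compII_A_nor: "compII (A_nor g H0 n w *v k) = compI (Sigma_mat g H0 w *v k) *\<^sub>R n"
  unfolding A_nor_mult G_mat_mult
  by (simp add: compII_def block_vec_def axis_def sum_2 vec_eq_iff forall_2)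

lemma det_Sigma_mat:
  "det (Sigma_mat g H0 w) = height H0 w * (g * height H0 w - (norm (vel w))\<^sup>2)"
  by (simp add: Sigma_mat_def block_mat_def block_vec_def compI_def compII_def mat_def det_3
      norm_vec_def L2_set_def sum_2 algebra_simps power2_eq_square)

text \<open>The second assumption forces g h > 0, hence h > 0 since g > 0; both factors of the
  determinant are then positive.\<close>

lemma invertible_Sigma_mat:
  assumes "0 < g" "0 < g * height H0 w - (norm (vel w))\<^sup>2"
  shows "invertible (Sigma_mat g H0 w)"
proof -
  have "0 < g * height H0 w"
    using assms(2) by (smt (verit) zero_le_power2)
  then show ?thesis
    using assms by (simp add: invertible_det_nz det_Sigma_mat zero_less_mult_iff)
qed

text \<open>The entries \<open>g\<close> and \<open>H0\<close> make \<open>Sigma_mat\<close> affine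
  in the state rather than linear; subtracting the value at 0 leaves its linear part.\<close>

lemma bounded_linear_Sigma_mat: "bounded_linear (\<lambda>w. Sigma_mat g H0 w - Sigma_mat g H0 0)"
  unfolding linear_conv_bounded_linear[symmetric]
  by (rule linearI; simp add: Sigma_mat_def block_mat_def block_vec_def compI_def compII_def
      mat_def vec_eq_iff forall_3; simp add: algebra_simps)

lemma Ck_on_1_Sigma_mat:
  fixes w :: "'a::euclidean_space \<Rightarrow> real^3"
  assumes "open S" "Ck_on 1 S w"
  shows "Ck_on 1 S (\<lambda>x. Sigma_mat g H0 (w x))"
proof -
  have "Ck_on 1 S (\<lambda>x. Sigma_mat g H0 (w x) - Sigma_mat g H0 0 + Sigma_mat g H0 0)"
    by (intro Ck_on_1_add Ck_on_1_const assms Ck_on_1_bounded_linear[OF _ bounded_linear_Sigma_mat])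
  then show ?thesis
    by (simp del: One_nat_def)
qed

lemma continuous_on_Sigma_mat:
  assumes "continuous_on S w"
  shows "continuous_on S (\<lambda>x. Sigma_mat g H0 (w x))"
proof -
  have "continuous_on S (\<lambda>x. Sigma_mat g H0 (w x) - Sigma_mat g H0 0 + Sigma_mat g H0 0)"
    by (intro continuous_on_add continuous_on_const assms
        bounded_linear.continuous_on[OF bounded_linear_Sigma_mat])
  then show ?thesis
    by simp
qed

section \<open>Equivalence of the two systems\<close>

lemma open_outside_curve:
  assumes "arclength_param \<Gamma> \<gamma> L"
  shows "open (outside \<Gamma>)"
proof -
  have "path (\<lambda>\<theta>. \<gamma> (L * \<theta>))" "\<Gamma> = path_image (\<lambda>\<theta>. \<gamma> (L * \<theta>))"
    using assms simple_path_imp_path unfolding arclength_param_def by blast+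
  then show ?thesis
    by (simp add: closed_path_image open_outside)
qed

text \<open>The normalization is stated along the parametrization, which reaches every point of the
  curve.\<close>

lemma norm_normal_on_curve:
  assumes "arclength_param \<Gamma> \<gamma> L" "outward_unit_normal \<Gamma> \<gamma> N" "x \<in> \<Gamma>"
  shows "norm (N x) = 1"
proof -
  obtain \<theta> where "x = \<gamma> (L * \<theta>)"
    using assms(1,3) unfolding arclength_param_def path_image_def by blast
  then show ?thesis
    using assms(2) unfolding outward_unit_normal_def by blast
qed

section \<open>Partial derivatives of jointly differentiable functions\<close>

lemma has_vector_derivative_dt:
  assumes "(\<lambda>(\<tau>, y). w \<tau> y) differentiable (at (t, x))"
  shows "((\<lambda>\<tau>. w \<tau> x) has_vector_derivative dt w t x) (at t)"
proof -
  have "(\<lambda>\<tau>. (\<tau>, x)) differentiable (at t)"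
    by (rule differentiableI[OF has_derivative_Pair[OF has_derivative_ident has_derivative_const]])
  from differentiable_chain_at[OF this assms] show ?thesis
    by (simp add: o_def dt_def vector_derivative_works)
qed

lemma differentiable_section:
  assumes "(\<lambda>(\<tau>, y). w \<tau> y) differentiable (at (t, x))"
  shows "w t differentiable (at x)"
proof -
  have "(\<lambda>y. (t, y)) differentiable (at x)"
    by (rule differentiableI[OF has_derivative_Pair[OF has_derivative_const has_derivative_ident]])
  from differentiable_chain_at[OF this assms] show ?thesis
    by (simp add: o_def)
qed

text \<open>This moves the constant matrix \<open>G_mat j\<close> out of the spatial
  derivative.\<close>

lemma dx_bounded_linear:
  assumes "bounded_linear F" "f differentiable (at x)"
  shows "dx j (\<lambda>y. F (f y)) x = F (dx j f x)"
proof -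
  have "((\<lambda>y. F (f y)) has_derivative (\<lambda>v. F (frechet_derivative f (at x) v))) (at x)"
    using assms(2) unfolding frechet_derivative_works
    by (rule bounded_linear.has_derivative[OF assms(1)])
  from frechet_derivative_at[OF this, symmetric] show ?thesis
    by (simp add: dx_def)
qed

text \<open>Applied with \<open>Sigma_mat\<close> along the state and with its inverse, this carries
  regularity between the two unknowns in both directions; the conditions on the boundary unknown are
  unchanged.\<close>

lemma regular_pair_matrix_mult:
  assumes "open (outside \<Gamma>)"
    and "Ck_on 1 ({0<..<T} \<times> outside \<Gamma>) (\<lambda>(t, x). M t x)"
    and "continuous_on ({0<..<T} \<times> closure (outside \<Gamma>)) (\<lambda>(t, x). M t x)"
    and "regular_pair T \<Gamma> hi w \<psi>"
  shows "regular_pair T \<Gamma> hi (\<lambda>t x. M t x *v w t x) \<psi>"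
proof -
  have "Ck_on 1 ({0<..<T} \<times> outside \<Gamma>) (\<lambda>p.
      (case p of (t, x) \<Rightarrow> M t x) *v (case p of (t, x) \<Rightarrow> w t x))"
    using assms unfolding regular_pair_def
    by (intro Ck_on_1_bilinear[OF _ bounded_bilinear_matrix_vector_mult] open_Times) auto
  moreover have "continuous_on ({0<..<T} \<times> closure (outside \<Gamma>))
      (\<lambda>p. (case p of (t, x) \<Rightarrow> M t x) *v (case p of (t, x) \<Rightarrow> w t x))"
    using assms unfolding regular_pair_def
    by (intro bounded_bilinear.continuous_on[OF bounded_bilinear_matrix_vector_mult]) auto
  ultimately show ?thesis
    using assms(4) unfolding regular_pair_def by (simp del: One_nat_def add: case_prod_unfold)
qed

text \<open>Multiplying by the symmetrizer and then by its inverse gives back the original unknown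
  only for times in (0,T) and points of the closed exterior, so equality there must suffice.\<close>

lemma regular_pair_cong:
  assumes "open (outside \<Gamma>)" "regular_pair T \<Gamma> hi w \<psi>"
    and eq: "\<And>t x. t \<in> {0<..<T} \<Longrightarrow> x \<in> closure (outside \<Gamma>) \<Longrightarrow> w t x = w' t x"
  shows "regular_pair T \<Gamma> hi w' \<psi>"
proof -
  have "Ck_on 1 ({0<..<T} \<times> outside \<Gamma>) (\<lambda>(t, x). w' t x)"
    by (rule Ck_on_1_cong[where f = "\<lambda>(t, x). w t x"])
      (use assms closure_subset[of "outside \<Gamma>"] in
        \<open>auto simp: regular_pair_def open_Times simp del: One_nat_def\<close>)
  moreover have "continuous_on ({0<..<T} \<times> closure (outside \<Gamma>)) (\<lambda>(t, x). w' t x)"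
    by (rule continuous_on_eq[where f = "\<lambda>(t, x). w t x"])
      (use assms in \<open>auto simp: regular_pair_def\<close>)
  ultimately show ?thesis
    using assms(2) unfolding regular_pair_def by blast
qed

lemma bounded_linear_compII: "bounded_linear compII"
  unfolding linear_conv_bounded_linear[symmetric]
  by (rule linearI) (simp_all add: compII_def vec_eq_iff forall_2)

text \<open>A non-strict bound survives limits. The positive constant \<open>c0\<close> thus keeps
  the symmetrizer invertible on the curve itself, where a strict inequality in the open exterior
  could degenerate.\<close>

lemma state_bound_on_closure:
  assumes cont: "continuous_on ({0<..<T} \<times> closure (outside \<Gamma>)) (\<lambda>(t, x). u t x)"
    and bound: "\<forall>t\<in>{0<..<T}. \<forall>x\<in>outside \<Gamma>. c0 \<le> g * height H0 (u t x) - (norm (vel (u t x)))\<^sup>2"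
    and t: "t \<in> {0<..<T}" and x: "x \<in> closure (outside \<Gamma>)"
  shows "c0 \<le> g * height H0 (u t x) - (norm (vel (u t x)))\<^sup>2"
proof -
  have "continuous_on (closure (outside \<Gamma>)) (\<lambda>x. case (t, x) of (t, x) \<Rightarrow> u t x)"
    by (rule continuous_on_compose2[OF cont]) (use t in \<open>auto intro: continuous_on_Pair\<close>)
  then have "continuous_on (closure (outside \<Gamma>)) (\<lambda>x. g * height H0 (u t x) - (norm (vel (u t x)))\<^sup>2)"
    by (intro continuous_intros bounded_linear.continuous_on[OF bounded_linear_compII])
      (auto simp: compI_def intro!: continuous_intros)
  from continuous_ge_on_closure[OF this x] bound t show ?thesis
    by blast
qed

theorem proposition11:
  fixes \<Gamma> :: "(real^2) set" and \<gamma> :: "real \<Rightarrow> real^2" and L \<rho> :: real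
    and N :: "real^2 \<Rightarrow> real^2" and \<chi>\<^sub>b hi :: "real^2 \<Rightarrow> real"
    and g H0 T c0 :: real and d :: direction
    and u u_dot :: "real \<Rightarrow> real^2 \<Rightarrow> real^3"
    and \<psi> \<psi>_dot :: "real \<Rightarrow> real^2 \<Rightarrow> real"
  assumes curve: "arclength_param \<Gamma> \<gamma> L"
    and normal: "outward_unit_normal \<Gamma> \<gamma> N"
    and coords: "tubular_coords \<gamma> L N \<rho>"
    and cutoff: "normal_cutoff \<Gamma> \<gamma> L N \<rho> \<chi>\<^sub>b"
    and g_pos: "0 < g" and H0_pos: "0 < H0" and T_pos: "0 < T"
    and hi_smooth: "smooth_closure (inside \<Gamma>) hi"
    and hi_pos: "\<exists>c>0. \<forall>x\<in>closure (inside \<Gamma>). c \<le> hi x"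
    and state: "regular_state d T \<Gamma> \<gamma> L N \<rho> hi u \<psi>"
    and c0_pos: "0 < c0"
    and subcritical: "\<forall>t\<in>{0<..<T}. \<forall>x\<in>outside \<Gamma>.
      c0 \<le> g * height H0 (u t x) - (norm (vel (u t x)))\<^sup>2"
  shows "(\<forall>t\<in>{0<..<T}. \<forall>x\<in>outside \<Gamma>. invertible (Sigma_mat g H0 (u t x))) \<and>
    ((regular_pair T \<Gamma> hi u_dot \<psi>_dot \<and>
      (\<forall>t\<in>{0<..<T}. \<forall>x\<in>outside \<Gamma>.
         dt u_dot t x + (\<Sum>j\<in>UNIV. dx j (\<lambda>y. A_mat g H0 j (u t y) *v u_dot t y) x)
           = f_dot d \<gamma> L N \<rho> \<chi>\<^sub>b g H0 u t x) \<and>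
      (\<forall>t\<in>{0<..<T}. \<forall>x\<in>\<Gamma>.
         compI (A_nor g H0 (N x) (u t x) *v u_dot t x) - DN_map \<Gamma> N hi (\<psi>_dot t) x
           = g1_src d \<Gamma> \<gamma> L N \<rho> hi \<psi> t x) \<and>
      (\<forall>t\<in>{0<..<T}. \<forall>x\<in>\<Gamma>.
         dt \<psi>_dot t x + N x \<bullet> compII (A_nor g H0 (N x) (u t x) *v u_dot t x)
           = g2_src d \<gamma> L N \<rho> g H0 u t x))
     \<longleftrightarrow>
     (let u_check = (\<lambda>t x. Sigma_mat g H0 (u t x) *v u_dot t x); \<psi>_check = \<psi>_dot in
      regular_pair T \<Gamma> hi u_check \<psi>_check \<and>
      (\<forall>t\<in>{0<..<T}. \<forall>x\<in>outside \<Gamma>.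
         dt u_check t x
           + (\<Sum>j\<in>UNIV. (Sigma_mat g H0 (u t x) ** G_mat j) *v dx j (u_check t) x)
           + B_mat g H0 u t x *v u_check t x
           = Sigma_mat g H0 (u t x) *v f_dot d \<gamma> L N \<rho> \<chi>\<^sub>b g H0 u t x) \<and>
      (\<forall>t\<in>{0<..<T}. \<forall>x\<in>\<Gamma>.
         N x \<bullet> compII (u_check t x) - DN_map \<Gamma> N hi (\<psi>_check t) x
           = g1_src d \<Gamma> \<gamma> L N \<rho> hi \<psi> t x) \<and>
      (\<forall>t\<in>{0<..<T}. \<forall>x\<in>\<Gamma>.
         dt \<psi>_check t x + compI (u_check t x) = g2_src d \<gamma> L N \<rho> g H0 u t x)))"
proof -
  let ?S = "{0<..<T} \<times> outside \<Gamma>" and ?K = "{0<..<T} \<times> closure (outside \<Gamma>)"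
  define M where "M = (\<lambda>t x. Sigma_mat g H0 (u t x))"
  define Minv where "Minv = (\<lambda>t x. matrix_inv (M t x))"
  define w where "w = (\<lambda>t x. Sigma_mat g H0 (u t x) *v u_dot t x)"
  have oE: "open (outside \<Gamma>)"
    using curve by (rule open_outside_curve)
  then have oS: "open ?S"
    by (simp add: open_Times)
  have u_C1: "Ck_on 1 ?S (\<lambda>(t, x). u t x)" and u_cont: "continuous_on ?K (\<lambda>(t, x). u t x)"
    using state unfolding regular_state_def by (blast intro: Ck_on_2_imp_Ck_on_1)+
  \<comment> \<open>Invertibility is required up to the curve because \<open>regular_pair\<close>
    asks for continuity up to the curve.\<close>
  have inv: "invertible (M t x)" if "t \<in> {0<..<T}" "x \<in> closure (outside \<Gamma>)" for t x
    using state_bound_on_closure[OF u_cont subcritical that] c0_pos g_pos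
    by (simp add: M_def invertible_Sigma_mat)
  have inv_S: "invertible (M t x)" if "t \<in> {0<..<T}" "x \<in> outside \<Gamma>" for t x
    using that inv closure_subset by blast
  have M_C1: "Ck_on 1 ?S (\<lambda>(t, x). M t x)"
    using Ck_on_1_Sigma_mat[OF oS u_C1] by (simp add: M_def case_prod_unfold del: One_nat_def)
  have M_cont: "continuous_on ?K (\<lambda>(t, x). M t x)"
    using continuous_on_Sigma_mat[OF u_cont] by (simp add: M_def case_prod_unfold)
  have Minv_C1: "Ck_on 1 ?S (\<lambda>(t, x). Minv t x)"
    using Ck_on_1_matrix_inv[OF oS M_C1] inv_S
    by (auto simp add: Minv_def case_prod_unfold simp del: One_nat_def)
  have Minv_cont: "continuous_on ?K (\<lambda>(t, x). Minv t x)"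
    using continuous_on_matrix_inv[OF M_cont] inv
    by (auto simp add: Minv_def case_prod_unfold)
  have u_dot_eq: "Minv t x *v w t x = u_dot t x"
    if "t \<in> {0<..<T}" "x \<in> closure (outside \<Gamma>)" for t x
    using matrix_inv(2)[OF inv[OF that]] by (simp add: Minv_def M_def w_def matrix_vector_mul_assoc)
  have regular: "regular_pair T \<Gamma> hi u_dot \<psi>_dot \<longleftrightarrow> regular_pair T \<Gamma> hi w \<psi>_dot"
  proof
    show "regular_pair T \<Gamma> hi w \<psi>_dot" if "regular_pair T \<Gamma> hi u_dot \<psi>_dot"
      using regular_pair_matrix_mult[OF oE M_C1 M_cont that] by (simp add: w_def M_def)
    show "regular_pair T \<Gamma> hi u_dot \<psi>_dot" if "regular_pair T \<Gamma> hi w \<psi>_dot"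
      by (rule regular_pair_cong[OF oE regular_pair_matrix_mult[OF oE Minv_C1 Minv_cont that]])
        (rule u_dot_eq)
  qed
  \<comment> \<open>The source is an arbitrary vector \<open>F\<close>: its structure does not
    enter. Regularity of \<open>w\<close> justifies the derivatives below.\<close>
  have interior: "dt u_dot t x + (\<Sum>j\<in>UNIV. dx j (\<lambda>y. A_mat g H0 j (u t y) *v u_dot t y) x) = F
      \<longleftrightarrow> dt w t x + (\<Sum>j\<in>UNIV. (M t x ** G_mat j) *v dx j (w t) x) + B_mat g H0 u t x *v w t x
        = M t x *v F"
    if w: "regular_pair T \<Gamma> hi w \<psi>_dot" and t: "t \<in> {0<..<T}" and x: "x \<in> outside \<Gamma>" for t x F
  proof -
    have xc: "x \<in> closure (outside \<Gamma>)"
      using x closure_subset by blast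
    have w_diff: "(\<lambda>(t, x). w t x) differentiable (at (t, x))"
      using w t x by (intro Ck_on_1_imp_differentiable[OF oS]) (auto simp: regular_pair_def)
    have Minv_diff: "(\<lambda>(t, x). Minv t x) differentiable (at (t, x))"
      using Minv_C1 t x by (intro Ck_on_1_imp_differentiable[OF oS]) auto
    \<comment> \<open>The product rule in time; the term in which the inverse is differentiated
      becomes the zeroth-order term with \<open>B_mat\<close>.\<close>
    have "((\<lambda>\<tau>. Minv \<tau> x *v w \<tau> x) has_vector_derivative
        Minv t x *v dt w t x + dt Minv t x *v w t x) (at t)"
      by (intro bounded_bilinear.has_vector_derivative[OF bounded_bilinear_matrix_vector_mult]
          has_vector_derivative_dt w_diff Minv_diff)
    \<comment> \<open>\<open>u_dot\<close> equals the product only for times in (0,T), an open set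
      containing \<open>t\<close>.\<close>
    then have "((\<lambda>\<tau>. u_dot \<tau> x) has_vector_derivative
        Minv t x *v dt w t x + dt Minv t x *v w t x) (at t)"
      by (rule has_vector_derivative_transform_within_open[OF _ open_greaterThanLessThan t])
        (use u_dot_eq xc in auto)
    then have "dt u_dot t x = Minv t x *v dt w t x + dt Minv t x *v w t x"
      by (simp add: dt_def vector_derivative_at)
    \<comment> \<open>The product under the derivative is \<open>G_mat j\<close> times
      \<open>w\<close>, so no derivative of the state appears.\<close>
    moreover have "dx j (\<lambda>y. A_mat g H0 j (u t y) *v u_dot t y) x = G_mat j *v dx j (w t) x" for j
      using dx_bounded_linear[OF matrix_vector_mul_bounded_linear differentiable_section[OF w_diff]]
      by (simp add: A_mat_eq w_def M_def matrix_vector_mul_assoc)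
    ultimately have lhs: "dt u_dot t x + (\<Sum>j\<in>UNIV. dx j (\<lambda>y. A_mat g H0 j (u t y) *v u_dot t y) x)
        = Minv t x *v dt w t x + dt Minv t x *v w t x + (\<Sum>j\<in>UNIV. G_mat j *v dx j (w t) x)"
      (is "?lhs = ?rhs")
      by simp
    have rhs: "M t x *v ?rhs
        = dt w t x + (\<Sum>j\<in>UNIV. (M t x ** G_mat j) *v dx j (w t) x) + B_mat g H0 u t x *v w t x"
    proof -
      have "M t x ** Minv t x = mat 1"
        using matrix_inv(1)[OF inv_S[OF t x]] by (simp only: Minv_def)
      moreover have "B_mat g H0 u t x = M t x ** dt Minv t x"
        by (simp only: B_mat_def Minv_def M_def)
      ultimately show ?thesis
        by (simp only: matrix_vector_right_distrib matrix_vector_mul_assoc matrix_vector_mul_lid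
            sum_2 ac_simps)
    qed
    \<comment> \<open>Cancelling the invertible factor makes multiplication of the equation by it
      reversible.\<close>
    have inj: "M t x *v a = M t x *v F \<longleftrightarrow> a = F" for a
    proof
      assume "M t x *v a = M t x *v F"
      then have "matrix_inv (M t x) *v (M t x *v a) = matrix_inv (M t x) *v (M t x *v F)"
        by (rule arg_cong)
      then show "a = F"
        by (simp only: matrix_vector_mul_assoc matrix_inv(2)[OF inv_S[OF t x]] matrix_vector_mul_lid)
    qed (rule arg_cong)
    show ?thesis
      by (simp only: lhs rhs[symmetric] inj)
  qed
  have boundary1: "compI (A_nor g H0 (N x) (u t x) *v u_dot t x) = N x \<bullet> compII (w t x)" for t x
    by (simp add: compI_A_nor w_def M_def)
  \<comment> \<open>Here the unit length of the normal on the curve enters, through N . N =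
    1.\<close>
  have boundary2: "N x \<bullet> compII (A_nor g H0 (N x) (u t x) *v u_dot t x) = compI (w t x)"
    if "x \<in> \<Gamma>" for t x
    using norm_normal_on_curve[OF curve normal that]
    by (simp add: compII_A_nor w_def M_def dot_square_norm)
  have invertible: "\<forall>t\<in>{0<..<T}. \<forall>x\<in>outside \<Gamma>. invertible (Sigma_mat g H0 (u t x))"
    using inv_S by (simp add: M_def)
  have pde: "(\<forall>t\<in>{0<..<T}. \<forall>x\<in>outside \<Gamma>.
       dt u_dot t x + (\<Sum>j\<in>UNIV. dx j (\<lambda>y. A_mat g H0 j (u t y) *v u_dot t y) x) = F t x)
     \<longleftrightarrow> (\<forall>t\<in>{0<..<T}. \<forall>x\<in>outside \<Gamma>.
       dt w t x + (\<Sum>j\<in>UNIV. (Sigma_mat g H0 (u t x) ** G_mat j) *v dx j (w t) x)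
         + B_mat g H0 u t x *v w t x = Sigma_mat g H0 (u t x) *v F t x)"
    if "regular_pair T \<Gamma> hi w \<psi>_dot" for F
    by (intro ball_cong refl interior[unfolded M_def] that)
  have boundary: "(\<forall>t\<in>{0<..<T}. \<forall>x\<in>\<Gamma>.
       dt \<psi>_dot t x + N x \<bullet> compII (A_nor g H0 (N x) (u t x) *v u_dot t x) = G t x)
     \<longleftrightarrow> (\<forall>t\<in>{0<..<T}. \<forall>x\<in>\<Gamma>. dt \<psi>_dot t x + compI (w t x) = G t x)" for G
    by (simp add: boundary2)
  \<comment> \<open>After rewriting, the two systems differ only in the interior equation;
    \<open>conj_cong\<close> supplies the shared regularity of \<open>w\<close> as the premise of
    \<open>pde\<close>.\<close>
  show ?thesis
    unfolding w_def[symmetric] Let_def regular boundary1 boundary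
    by (rule conjI, rule invertible, rule conj_cong, rule refl, rule conj_cong, erule pde, rule refl)
qed

end
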